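(* Let $H$ be a complex Hilbert space and let $A\in\mathcal{B}(H)$ be antilinear and self-adjoint. Then for every continuous biradial function $\hat f:\sigma(A)\to\mathbb{C}$, $\hat f(\lambda)=u(|\lambda|^2)+v(|\lambda|^2)\lambda$ with $u,v:\sigma(A^2)\to\mathbb{C}$ continuous, $$\hat f(\sigma(A))=\sigma(f(A)),\qquad\text{where } f(A)=u(A^2)+v(A^2)A.$$
   Context: $\mathcal{B}(H)$ denotes the set of bounded real linear operators on $H$. An operator $A$ is antilinear if it is real linear and $A\lambda=\overline{\lambda}A$ for all $\lambda\in\mathbb{C}$. The adjoint $B^*$ of $B\in\mathcal{B}(H)$ is the real linear operator with $\mathrm{Re}(Bx,y)=\mathrm{Re}(x,B^*y)$ for all $x,y\in H$; $B$ is self-adjoint if $B^*=B$. The spectrum $\sigma(B)$ of $B\in\mathcal{B}(H)$ is the set of $\lambda\in\mathbb{C}$ such that $\lambda I-B$ (where $\lambda I$ is multiplication by the complex scalar $\lambda$) is not boundedly invertible as a real linear operator. For antilinear self-adjoint $A$, the operator $A^2$ is complex linear, self-adjoint and positive semidefinite; $\sigma(A^2)\subset[0,\infty)$ is compact, $u(A^2),v(A^2)$ are given by the continuous functional calculus, and $\lambda\in\sigma(A)$ if and only if $|\lambda|^2\in\sigma(A^2)$. The operator $f(A)$ is in general only real linear. *)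

theory Defs
  imports "HOL-Analysis.Analysis" "HOL-Computational_Algebra.Polynomial"
begin

class complex_vector = real_vector +
  fixes scaleC :: "complex \<Rightarrow> 'a \<Rightarrow> 'a" (infixr "*\<^sub>C" 75)
  assumes scaleC_add_right: "a *\<^sub>C (x + y) = a *\<^sub>C x + a *\<^sub>C y"
    and scaleC_add_left: "(a + b) *\<^sub>C x = a *\<^sub>C x + b *\<^sub>C x"
    and scaleC_scaleC: "a *\<^sub>C b *\<^sub>C x = (a * b) *\<^sub>C x"
    and scaleC_of_real: "complex_of_real r *\<^sub>C x = r *\<^sub>R x"

text \<open>The complex inner product is linear in its first argument. Its real part is the library's
  real inner product, so norm, topology and boundedness are those of the underlying real space.\<close>

class complex_inner = complex_vector + real_inner +
  fixes cinner :: "'a \<Rightarrow> 'a \<Rightarrow> complex"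
  assumes cinner_commute: "cinner x y = cnj (cinner y x)"
    and cinner_add_left: "cinner (x + y) z = cinner x z + cinner y z"
    and cinner_scaleC_left: "cinner (a *\<^sub>C x) y = a * cinner x y"
    and Re_cinner: "Re (cinner x y) = inner x y"

class complex_hilbert_space = complex_inner + complete_space

lemma cinner_scaleC_right: "cinner x (a *\<^sub>C y) = cnj a * cinner x y"
  for x y :: "'a::complex_inner"
  by (metis cinner_commute cinner_scaleC_left complex_cnj_mult)

lemma norm_scaleC: "norm (a *\<^sub>C x) = cmod a * norm x"
  for x :: "'a::complex_inner"
proof -
  have "cinner (a *\<^sub>C x) (a *\<^sub>C x) = complex_of_real ((cmod a)\<^sup>2) * cinner x x"
    by (simp add: cinner_scaleC_left cinner_scaleC_right mult.assoc[symmetric]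
        complex_norm_square del: of_real_power)
  then have "Re (cinner (a *\<^sub>C x) (a *\<^sub>C x)) = (cmod a)\<^sup>2 * Re (cinner x x)"
    by (simp only: Re_complex_of_real times_complex.sel Im_complex_of_real)
  then have "inner (a *\<^sub>C x) (a *\<^sub>C x) = (cmod a)\<^sup>2 * inner x x"
    by (simp only: Re_cinner)
  then show ?thesis
    by (simp add: norm_eq_sqrt_inner real_sqrt_mult)
qed

text \<open>Bounded real linear operators on \<open>H\<close> are the elements of the library type of bounded linear
  maps from \<open>H\<close> to \<open>H\<close>, where linearity is over the reals. Here \<open>scalar_op c\<close> is \<open>c I\<close>.\<close>

lift_definition scalar_op :: "complex \<Rightarrow> 'a::complex_inner \<Rightarrow>\<^sub>L 'a"
  is "\<lambda>c x. c *\<^sub>C x"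
proof (rule bounded_linear_intro)
  fix c :: complex and x y :: 'a and r :: real
  show "c *\<^sub>C (x + y) = c *\<^sub>C x + c *\<^sub>C y"
    by (rule scaleC_add_right)
  show "c *\<^sub>C r *\<^sub>R x = r *\<^sub>R c *\<^sub>C x"
    by (simp add: scaleC_of_real[symmetric] scaleC_scaleC mult.commute)
  show "norm (c *\<^sub>C x) \<le> norm x * cmod c"
    by (simp add: norm_scaleC mult.commute)
qed

definition antilinear :: "('a::complex_inner \<Rightarrow>\<^sub>L 'a) \<Rightarrow> bool"
  where "antilinear A \<longleftrightarrow> (\<forall>c. A o\<^sub>L scalar_op c = scalar_op (cnj c) o\<^sub>L A)"

definition is_adjoint :: "('a::complex_inner \<Rightarrow>\<^sub>L 'a) \<Rightarrow> ('a \<Rightarrow>\<^sub>L 'a) \<Rightarrow> bool"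
  where "is_adjoint B C \<longleftrightarrow> (\<forall>x y. Re (cinner (B x) y) = Re (cinner x (C y)))"

text \<open>The adjoint is unique, so \<open>self_adjoint B\<close> says that the adjoint of \<open>B\<close> is \<open>B\<close> itself.\<close>

lemma is_adjoint_unique: "is_adjoint B C \<Longrightarrow> is_adjoint B D \<Longrightarrow> C = D"
  by (rule blinfun_eqI) (metis is_adjoint_def Re_cinner vector_eq_ldot)

definition self_adjoint :: "('a::complex_inner \<Rightarrow>\<^sub>L 'a) \<Rightarrow> bool"
  where "self_adjoint B \<longleftrightarrow> is_adjoint B B"

text \<open>The inverse is only required to be real linear and bounded.\<close>

definition boundedly_invertible :: "('a::complex_inner \<Rightarrow>\<^sub>L 'a) \<Rightarrow> bool"
  where "boundedly_invertible B \<longleftrightarrow>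
    (\<exists>C :: 'a \<Rightarrow>\<^sub>L 'a. C o\<^sub>L B = id_blinfun \<and> B o\<^sub>L C = id_blinfun)"

definition spectrum :: "('a::complex_inner \<Rightarrow>\<^sub>L 'a) \<Rightarrow> complex set"
  where "spectrum B = {c. \<not> boundedly_invertible (scalar_op c - B)}"

definition op_power :: "('a::complex_inner \<Rightarrow>\<^sub>L 'a) \<Rightarrow> nat \<Rightarrow> 'a \<Rightarrow>\<^sub>L 'a"
  where "op_power T n = (((o\<^sub>L) T) ^^ n) id_blinfun"

definition poly_op :: "complex poly \<Rightarrow> ('a::complex_inner \<Rightarrow>\<^sub>L 'a) \<Rightarrow> 'a \<Rightarrow>\<^sub>L 'a"
  where "poly_op p T = (\<Sum>i\<le>degree p. scalar_op (coeff p i) o\<^sub>L op_power T i)"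

text \<open>The continuous functional calculus \<open>g(T)\<close> of a complex linear self-adjoint \<open>T\<close>: the common
  limit, in operator norm, of \<open>p\<^sub>n(T)\<close> over all sequences of polynomials \<open>p\<^sub>n\<close> converging to \<open>g\<close>
  uniformly on the spectrum of \<open>T\<close>. For such \<open>T\<close> on a Hilbert space and \<open>g\<close> continuous on the
  spectrum, approximating polynomials exist (Weierstrass, as the spectrum is real and compact), and
  the limit exists and is independent of the choice since the norm of \<open>p(T)\<close> is the supremum of
  \<open>|p|\<close> on the spectrum. Only the values of \<open>g\<close> on the spectrum matter.\<close>

definition cont_fun_calc :: "(complex \<Rightarrow> complex) \<Rightarrow> ('a::complex_inner \<Rightarrow>\<^sub>L 'a) \<Rightarrow> 'a \<Rightarrow>\<^sub>L 'a"
  where "cont_fun_calc g T = (THE S. \<forall>p :: nat \<Rightarrow> complex poly.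
    uniform_limit (spectrum T) (\<lambda>n. poly (p n)) g sequentially \<longrightarrow>
    (\<lambda>n. poly_op (p n) T) \<longlonglongrightarrow> S)"

end

theory Submission
  imports Defs "HOL-Computational_Algebra.Fundamental_Theorem_Algebra"
begin

text \<open>Put \<open>T = A\<^sup>2\<close>, \<open>a = c - u(T)\<close>, \<open>b = v(T)\<close>. Since \<open>A g(T) = cnj g(T) A\<close>, the operator
  \<open>K = c - f(A) = a - b A\<close> commutes with \<open>L = cnj a + b A\<close> and \<open>K L = d(T)\<close>, where
  \<open>d(t) = |c - u(t)|\<^sup>2 - t |v(t)|\<^sup>2\<close>. If \<open>d\<close> has no zero on the spectrum of \<open>T\<close>, then \<open>d(T)\<close> and hence
  \<open>K\<close> is invertible; a zero \<open>t\<close> of \<open>d\<close> yields \<open>z\<close> with \<open>|z|\<^sup>2 = t\<close> and \<open>c = u(t) + v(t) z\<close>.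
  Conversely, every \<open>z\<close> with \<open>|z|\<^sup>2\<close> in the spectrum of \<open>T\<close> is an approximate eigenvalue of \<open>A\<close>, and
  its approximate eigenvectors are approximate eigenvectors of \<open>f(A)\<close> for \<open>u(|z|\<^sup>2) + v(|z|\<^sup>2) z\<close>.

  The functional calculus exists because the norm of \<open>p(T)\<close> equals \<open>|p(z)|\<close> for some \<open>z\<close> in the
  spectrum: \<open>p(T)\<^sup>* p(T) - \<parallel>p(T)\<parallel>\<^sup>2\<close> is a polynomial in \<open>T\<close> that is not bounded below, so one of the
  linear factors of that polynomial is not invertible.\<close>

section \<open>Bounded real linear operators on a complex Hilbert space\<close>

text \<open>With values in a Banach space the operators form a Banach space too, so Cauchy sequences
  \<open>poly_op (p n) T\<close> converge.\<close>

instance complex_hilbert_space \<subseteq> banach ..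

interpretation scaleC: bounded_bilinear "scaleC :: complex \<Rightarrow> 'a::complex_inner \<Rightarrow> 'a"
proof
  fix a b :: complex and x y :: 'a and r :: real
  show "(a + b) *\<^sub>C x = a *\<^sub>C x + b *\<^sub>C x" by (rule scaleC_add_left)
  show "a *\<^sub>C (x + y) = a *\<^sub>C x + a *\<^sub>C y" by (rule scaleC_add_right)
  show "(r *\<^sub>R a) *\<^sub>C x = r *\<^sub>R (a *\<^sub>C x)"
    by (simp add: scaleC_of_real[symmetric] scaleC_scaleC scaleR_conv_of_real)
  show "a *\<^sub>C (r *\<^sub>R x) = r *\<^sub>R (a *\<^sub>C x)"
    by (simp add: scaleC_of_real[symmetric] scaleC_scaleC mult.commute)
  show "\<exists>K. \<forall>(a::complex) (x::'a). norm (a *\<^sub>C x) \<le> norm a * norm x * K"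
    by (rule exI[of _ 1]) (simp add: norm_scaleC)
qed

lemma scaleC_one [simp]: "1 *\<^sub>C x = (x::'a::complex_vector)"
  using scaleC_of_real[of 1 x] by simp

lemma inner_scaleC_left: "inner (a *\<^sub>C x) y = inner x (cnj a *\<^sub>C y)"
  for x y :: "'a::complex_inner"
  by (simp add: Re_cinner[symmetric] cinner_scaleC_left cinner_scaleC_right)

lemma blinfun_compose_eqI:
  "(\<And>x. blinfun_apply B (blinfun_apply C x) = x) \<Longrightarrow> B o\<^sub>L C = id_blinfun"
  by (rule blinfun_eqI) simp

lemma blinfun_compose_assoc: "(B o\<^sub>L C) o\<^sub>L D = B o\<^sub>L (C o\<^sub>L D)"
  by (rule blinfun_eqI) simp

lemma boundedly_invertible_bounded_below:
  assumes "boundedly_invertible B"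
  obtains k where "k > 0" "\<And>x. k * norm x \<le> norm (blinfun_apply B x)"
proof -
  obtain C where C: "C o\<^sub>L B = id_blinfun"
    using assms by (auto simp: boundedly_invertible_def)
  \<comment> \<open>Adding 1 keeps the constant positive on the zero space, where
    \<open>C = 0\<close>.\<close>
  have "norm x \<le> (norm C + 1) * norm (blinfun_apply B x)" for x
  proof -
    have "x = blinfun_apply C (blinfun_apply B x)"
      by (metis C blinfun_apply_blinfun_compose id_blinfun.rep_eq)
    then have "norm x \<le> norm C * norm (blinfun_apply B x)"
      using norm_blinfun by metis
    also have "\<dots> \<le> (norm C + 1) * norm (blinfun_apply B x)"
      by (simp add: mult_right_mono)
    finally show ?thesis .
  qed
  then have "inverse (norm C + 1) * norm x \<le> norm (blinfun_apply B x)" for x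
    by (simp add: field_simps add_pos_nonneg)
  moreover have "inverse (norm C + 1) > 0"
    by (simp add: add_nonneg_pos)
  ultimately show ?thesis using that by blast
qed

text \<open>The lower bound serves twice: it gives injectivity, and it bounds the inverse by
  \<open>inverse k\<close>.\<close>

lemma boundedly_invertibleI_surj:
  assumes k: "k > 0" "\<And>x. k * norm x \<le> norm (blinfun_apply B x)"
    and surj: "\<And>y. \<exists>x. blinfun_apply B x = y"
  shows "boundedly_invertible B"
proof -
  obtain C where C: "\<And>y. blinfun_apply B (C y) = y"
    using surj by metis
  have inj: "x = y" if "blinfun_apply B x = blinfun_apply B y" for x y
    using k(2)[of "x - y"] k(1) that by (simp add: blinfun.diff_right mult_le_0_iff)
  have "bounded_linear C"
  proof (rule bounded_linear_intro)
    show "C (x + y) = C x + C y" for x y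
      by (rule inj) (simp add: C blinfun.add_right)
    show "C (r *\<^sub>R x) = r *\<^sub>R C x" for r x
      by (rule inj) (simp add: C blinfun.scaleR_right)
    show "norm (C x) \<le> norm x * inverse k" for x
      using k(2)[of "C x"] k(1) by (simp add: C field_simps)
  qed
  then have Cb: "blinfun_apply (Blinfun C) = C"
    by (rule bounded_linear_Blinfun_apply)
  have "Blinfun C o\<^sub>L B = id_blinfun" "B o\<^sub>L Blinfun C = id_blinfun"
    unfolding Cb by (rule blinfun_compose_eqI, metis Cb C inj)+
  then show ?thesis
    unfolding boundedly_invertible_def by blast
qed

text \<open>Lax--Milgram: for a coercive \<open>S\<close> and small \<open>r > 0\<close> the map \<open>x \<mapsto> x - r (S x - y)\<close> is a
  contraction, and its fixed point solves \<open>S x = y\<close>.\<close>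

lemma boundedly_invertible_coercive:
  fixes S :: "'a::complex_hilbert_space \<Rightarrow>\<^sub>L 'a"
  assumes c: "c > 0" "\<And>x. c * (norm x)\<^sup>2 \<le> inner (S x) x"
  shows "boundedly_invertible S"
proof (rule boundedly_invertibleI_surj[OF c(1)])
  show "c * norm x \<le> norm (S x)" for x
  proof (cases "x = 0")
    case False
    have "c * norm x * norm x \<le> norm (S x) * norm x"
      using c(2)[of x] norm_cauchy_schwarz[of "S x" x] by (simp add: power2_eq_square)
    then show ?thesis using False by simp
  qed simp
  fix y
  define M where "M = norm S + c"
  have M: "M > 0" "norm S \<le> M" "c \<le> M"
    using c(1) by (auto simp: M_def add_nonneg_pos)
  \<comment> \<open>This \<open>r\<close> minimises the factor
    \<open>1 - 2 * r * c + r\<^sup>2 * M\<^sup>2\<close>, whose minimum is \<open>q\<close>. The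
    summand \<open>c\<close> in \<open>M\<close> ensures \<open>q \<ge> 0\<close>.\<close>
  define r where "r = c / M\<^sup>2"
  have r: "r > 0" using c M by (simp add: r_def)
  define q where "q = 1 - c\<^sup>2 / M\<^sup>2"
  have q: "0 \<le> q" "q < 1"
    using c M by (auto simp: q_def divide_simps power_mono)
  have contr: "dist (x - r *\<^sub>R (S x - y)) (x' - r *\<^sub>R (S x' - y)) \<le> sqrt q * dist x x'" for x x'
  proof -
    define d where "d = x - x'"
    have "norm (S d) \<le> M * norm d"
      using norm_blinfun[of S d] M by (meson mult_right_mono norm_ge_zero order_trans)
    then have "(norm (S d))\<^sup>2 \<le> M\<^sup>2 * (norm d)\<^sup>2"
      by (metis norm_ge_zero power_mono power_mult_distrib)
    then have 1: "r\<^sup>2 * (norm (S d))\<^sup>2 \<le> r\<^sup>2 * (M\<^sup>2 * (norm d)\<^sup>2)"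
      by (intro mult_left_mono) auto
    have 2: "r * (c * (norm d)\<^sup>2) \<le> r * inner (S d) d"
      using c r by (intro mult_left_mono) auto
    have "(norm (d - r *\<^sub>R S d))\<^sup>2 = (norm d)\<^sup>2 - 2 * (r * inner (S d) d) + r\<^sup>2 * (norm (S d))\<^sup>2"
      unfolding power2_norm_eq_inner
      by (simp add: inner_diff_left inner_diff_right inner_commute power2_eq_square)
    also have "\<dots> \<le> (norm d)\<^sup>2 - 2 * (r * (c * (norm d)\<^sup>2)) + r\<^sup>2 * (M\<^sup>2 * (norm d)\<^sup>2)"
      using 1 2 by linarith
    also have "\<dots> = q * (norm d)\<^sup>2"
      using M by (simp add: q_def r_def field_simps power2_eq_square)
    finally have "norm (d - r *\<^sub>R S d) \<le> sqrt (q * (norm d)\<^sup>2)"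
      by (rule real_le_rsqrt)
    moreover have "(x - r *\<^sub>R (S x - y)) - (x' - r *\<^sub>R (S x' - y)) = d - r *\<^sub>R S d"
      unfolding d_def blinfun.diff_right scaleR_diff_right by (simp only: algebra_simps)
    ultimately show ?thesis
      unfolding dist_norm by (simp only: real_sqrt_mult real_sqrt_abs abs_norm_cancel flip: d_def)
  qed
  have "\<exists>!x. x - r *\<^sub>R (S x - y) = x"
  proof (rule banach_fix_type[of "sqrt q"])
    show "0 \<le> sqrt q" "sqrt q < 1" using q by auto
    show "\<forall>x x'. dist (x - r *\<^sub>R (S x - y)) (x' - r *\<^sub>R (S x' - y)) \<le> sqrt q * dist x x'"
      using contr by blast
  qed
  then obtain x where "x - r *\<^sub>R (S x - y) = x" by blast
  then have "r *\<^sub>R (S x - y) = 0" by (simp only: diff_eq_eq) (metis add_cancel_right_right)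
  then show "\<exists>x. S x = y"
    using r by (intro exI[of _ x]) simp
qed

lemma boundedly_invertible_compose:
  "boundedly_invertible B \<Longrightarrow> boundedly_invertible C \<Longrightarrow> boundedly_invertible (B o\<^sub>L C)"
proof -
  assume "boundedly_invertible B" "boundedly_invertible C"
  then obtain B' C' where *: "B' o\<^sub>L B = id_blinfun" "B o\<^sub>L B' = id_blinfun"
      "C' o\<^sub>L C = id_blinfun" "C o\<^sub>L C' = id_blinfun"
    by (auto simp: boundedly_invertible_def)
  note * = *[THEN arg_cong[where f = blinfun_apply], THEN fun_cong, simplified]
  show ?thesis
    unfolding boundedly_invertible_def
    by (intro exI[of _ "C' o\<^sub>L B'"] conjI blinfun_compose_eqI) (simp_all add: *)
qed

text \<open>With \<open>E\<close> inverse to \<open>D\<close>, the operator \<open>E C\<close> is a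
  left and \<open>C E\<close> a right inverse of \<open>B\<close>, so the two coincide. It is
  applied to commuting factorisations of operators known to be invertible.\<close>

lemma boundedly_invertible_of_commuting:
  assumes eq: "B o\<^sub>L C = D" "C o\<^sub>L B = D" and D: "boundedly_invertible D"
  shows "boundedly_invertible B"
proof -
  obtain E where E: "E o\<^sub>L D = id_blinfun" "D o\<^sub>L E = id_blinfun"
    using D by (auto simp: boundedly_invertible_def)
  have 1: "(E o\<^sub>L C) o\<^sub>L B = id_blinfun"
    using E(1) eq(2) by (simp add: blinfun_compose_assoc)
  have 2: "B o\<^sub>L (C o\<^sub>L E) = id_blinfun"
    using E(2) eq(1) by (simp add: blinfun_compose_assoc[symmetric])
  have "E o\<^sub>L C = C o\<^sub>L E"
  proof (rule blinfun_eqI)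
    fix x
    note * = 1[THEN arg_cong[where f = blinfun_apply], THEN fun_cong, simplified]
      2[THEN arg_cong[where f = blinfun_apply], THEN fun_cong, simplified]
    show "blinfun_apply (E o\<^sub>L C) x = blinfun_apply (C o\<^sub>L E) x"
      using *(1)[of "blinfun_apply C (blinfun_apply E x)"] by (simp add: *(2))
  qed
  then show ?thesis
    using 1 2 unfolding boundedly_invertible_def by metis
qed

lemma boundedly_invertible_scalar_op:
  "c \<noteq> 0 \<Longrightarrow> boundedly_invertible (scalar_op c)"
  unfolding boundedly_invertible_def
  by (intro exI[of _ "scalar_op (inverse c)"] conjI blinfun_compose_eqI)
    (simp_all add: scalar_op.rep_eq scaleC_scaleC)

lemma boundedly_invertible_minus_commute:
  "boundedly_invertible (B - C) \<longleftrightarrow> boundedly_invertible (C - B)"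
proof -
  have *: "boundedly_invertible (C - B)" if inv: "boundedly_invertible (B - C)" for B C
  proof -
    obtain E where E: "E o\<^sub>L (B - C) = id_blinfun" "(B - C) o\<^sub>L E = id_blinfun"
      using inv by (auto simp: boundedly_invertible_def)
    note E = E[THEN arg_cong[where f = blinfun_apply], THEN fun_cong, simplified]
    show ?thesis
      unfolding boundedly_invertible_def
      by (rule exI[of _ "- E"])
        (use E in \<open>auto intro!: blinfun_compose_eqI
          simp: blinfun.diff_left blinfun.diff_right blinfun.minus_left blinfun.minus_right\<close>)
  qed
  show ?thesis using * by blast
qed

text \<open>Approximate eigenvectors prevent \<open>z I - B\<close> from being bounded below. Only
  real linearity of \<open>B\<close> enters, so f(A) is covered.\<close>

lemma approx_eigenvector_spectrum:
  assumes "\<And>e. e > 0 \<Longrightarrow> \<exists>x. norm x = 1 \<and> norm (blinfun_apply B x - z *\<^sub>C x) < e"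
  shows "z \<in> spectrum B"
proof (rule ccontr)
  assume "z \<notin> spectrum B"
  then have "boundedly_invertible (scalar_op z - B)"
    by (simp add: spectrum_def)
  then obtain k where k: "k > 0" "\<And>x. k * norm x \<le> norm (blinfun_apply (scalar_op z - B) x)"
    using boundedly_invertible_bounded_below by blast
  obtain x where "norm x = 1" "norm (blinfun_apply B x - z *\<^sub>C x) < k"
    using assms k by blast
  with k(2)[of x] show False
    by (simp add: blinfun.diff_left scalar_op.rep_eq norm_minus_commute)
qed

section \<open>Operator polynomials and polynomial approximation\<close>

lemma op_power_simps [simp]:
  "blinfun_apply (op_power T 0) x = x"
  "blinfun_apply (op_power T (Suc n)) x = blinfun_apply T (blinfun_apply (op_power T n) x)"
  by (simp_all add: op_power_def)

text \<open>A free upper limit \<open>N\<close> lets polynomials of different degrees be summed over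
  the same range.\<close>

lemma blinfun_apply_poly_op:
  assumes "degree p \<le> N"
  shows "blinfun_apply (poly_op p T) x = (\<Sum>i\<le>N. coeff p i *\<^sub>C blinfun_apply (op_power T i) x)"
proof -
  have "blinfun_apply (poly_op p T) x
      = (\<Sum>i\<le>degree p. coeff p i *\<^sub>C blinfun_apply (op_power T i) x)"
    by (simp add: poly_op_def blinfun.sum_left scalar_op.rep_eq)
  also have "\<dots> = (\<Sum>i\<le>N. coeff p i *\<^sub>C blinfun_apply (op_power T i) x)"
    by (rule sum.mono_neutral_left) (use assms in \<open>auto simp: coeff_eq_0 scaleC.zero_left\<close>)
  finally show ?thesis .
qed

lemma poly_op_0 [simp]: "poly_op 0 T = 0"
  by (rule blinfun_eqI) (simp add: blinfun_apply_poly_op[of _ 0] scaleC.zero_left)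

lemma poly_op_diff: "poly_op (p - q) T = poly_op p T - poly_op q T"
proof (rule blinfun_eqI)
  fix x
  let ?N = "max (degree p) (degree q)"
  have "degree (p - q) \<le> ?N" by (rule degree_diff_le_max)
  then show "blinfun_apply (poly_op (p - q) T) x = blinfun_apply (poly_op p T - poly_op q T) x"
    by (simp add: blinfun_apply_poly_op[of _ ?N] blinfun.diff_left sum_subtractf scaleC.diff_left)
qed

lemma poly_op_add: "poly_op (p + q) T = poly_op p T + poly_op q T"
  using poly_op_diff[of "p + q" q T] by simp

lemma poly_op_smult: "blinfun_apply (poly_op (smult a p) T) x = a *\<^sub>C blinfun_apply (poly_op p T) x"
proof -
  have "degree (smult a p) \<le> degree p" by (rule degree_smult_le)
  then show ?thesis
    by (simp add: blinfun_apply_poly_op[of _ "degree p"] scaleC.sum_right scaleC_scaleC)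
qed

text \<open>On a real set Stone-Weierstrass applies to the real parameter. The real and imaginary
  parts of each approximant are real polynomials, which recombine into one complex
  polynomial.\<close>

lemma Weierstrass_complex_poly:
  fixes g :: "complex \<Rightarrow> complex"
  assumes S: "compact S" and real: "S \<subseteq> \<real>" and g: "continuous_on S g"
  obtains p where "uniform_limit S (\<lambda>n. poly (p n)) g sequentially"
proof -
  define R where "R = Re ` S"
  have inS: "complex_of_real x \<in> S" if "x \<in> R" for x
    using that real by (auto simp: R_def Reals_def)
  have "compact R"
    unfolding R_def by (intro compact_continuous_image S continuous_intros)
  moreover have "continuous_on R (\<lambda>x. g (complex_of_real x))"
    by (rule continuous_on_compose2[OF g]) (auto intro!: continuous_intros inS)
  ultimately obtain h where h: "uniform_limit R h (\<lambda>x. g (complex_of_real x)) sequentially"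
      "\<And>n. polynomial_function (h n)"
    using Stone_Weierstrass_uniform_limit by blast
  have "\<exists>p. \<forall>x. poly p (complex_of_real x) = h n x" for n
  proof -
    have "real_polynomial_function (Re \<circ> h n)" "real_polynomial_function (Im \<circ> h n)"
      using h(2)[of n] bounded_linear_Re bounded_linear_Im
      unfolding polynomial_function_def by blast+
    then obtain a k b l where "Re \<circ> h n = (\<lambda>x. \<Sum>i\<le>k. a i * x ^ i)"
        "Im \<circ> h n = (\<lambda>x. \<Sum>i\<le>l. b i * x ^ i)"
      unfolding real_polynomial_function_iff_sum by blast
    then have "Re (h n x) = (\<Sum>i\<le>k. a i * x ^ i)" "Im (h n x) = (\<Sum>i\<le>l. b i * x ^ i)" for x
      by (auto simp: fun_eq_iff)
    then have "poly ((\<Sum>i\<le>k. monom (complex_of_real (a i)) i)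
        + smult \<i> (\<Sum>i\<le>l. monom (complex_of_real (b i)) i)) (complex_of_real x) = h n x" for x
      by (subst (2) complex_eq) (simp add: poly_sum poly_monom)
    then show ?thesis by blast
  qed
  then obtain p where p: "\<And>n x. poly (p n) (complex_of_real x) = h n x"
    by metis
  have "uniform_limit S (\<lambda>n. poly (p n)) g sequentially"
  proof (rule uniform_limitI)
    fix e :: real assume "e > 0"
    from uniform_limitD[OF h(1) this]
    show "\<forall>\<^sub>F n in sequentially. \<forall>z\<in>S. dist (poly (p n) z) (g z) < e"
    proof eventually_elim
      case (elim n)
      show ?case
      proof
        fix z assume z: "z \<in> S"
        then have "complex_of_real (Re z) = z"
          using real by (auto simp: Reals_def)
        with z elim p[of n "Re z"] show "dist (poly (p n) z) (g z) < e"
          by (force simp: R_def)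
      qed
    qed
  qed
  then show ?thesis by (rule that)
qed

section \<open>Functional calculus of a complex linear self-adjoint operator\<close>

lemma poly_diff_fun: "poly (p - q) = (\<lambda>z. poly p z - poly q z)"
  for p q :: "'a::comm_ring poly"
  by (rule ext) simp

text \<open>Symmetry is stated for the real inner product; together with complex linearity this is
  the usual self-adjointness.\<close>

locale self_adjoint_operator =
  fixes T :: "'a::complex_hilbert_space \<Rightarrow>\<^sub>L 'a"
  assumes scaleC: "T (c *\<^sub>C x) = c *\<^sub>C T x"
    and adj: "inner (T x) y = inner x (T y)"
begin

lemma poly_op_pCons: "poly_op (pCons a p) T x = a *\<^sub>C x + T (poly_op p T x)"
proof -
  have "poly_op (pCons a p) T x
      = (\<Sum>i\<le>Suc (degree p). coeff (pCons a p) i *\<^sub>C op_power T i x)"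
    by (rule blinfun_apply_poly_op) (rule degree_pCons_le)
  also have "\<dots> = a *\<^sub>C x + T (\<Sum>i\<le>degree p. coeff p i *\<^sub>C op_power T i x)"
    by (simp add: sum.atMost_Suc_shift blinfun.sum_right scaleC del: sum.atMost_Suc)
  also have "(\<Sum>i\<le>degree p. coeff p i *\<^sub>C op_power T i x) = poly_op p T x"
    by (rule blinfun_apply_poly_op[symmetric]) simp
  finally show ?thesis .
qed

lemma poly_op_scaleC: "poly_op p T (c *\<^sub>C x) = c *\<^sub>C poly_op p T x"
  by (induction p) (simp_all add: poly_op_pCons scaleC scaleC.add_right scaleC_scaleC
      scaleC.zero_right mult.commute)

lemma poly_op_mult: "poly_op (p * q) T = poly_op p T o\<^sub>L poly_op q T"
proof (rule blinfun_eqI)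
  fix x show "poly_op (p * q) T x = (poly_op p T o\<^sub>L poly_op q T) x"
    by (induction p) (simp_all add: poly_op_pCons poly_op_add poly_op_smult blinfun.add_left
        scaleC.zero_left)
qed

lemma poly_op_const: "poly_op [:c:] T = scalar_op c"
  by (rule blinfun_eqI) (simp add: poly_op_pCons scalar_op.rep_eq)

lemma poly_op_X: "poly_op [:0, 1:] T = T"
  by (rule blinfun_eqI) (simp add: poly_op_pCons scaleC.zero_left)

lemma poly_op_adj: "inner (poly_op p T x) y = inner x (poly_op (map_poly cnj p) T y)"
proof (induction p arbitrary: x y)
  case (pCons a p)
  \<comment> \<open>Moving \<open>T\<close> and then \<open>p(T)\<close> across the inner product
    leaves \<open>T\<close> innermost, so it has to be commuted to the outside.\<close>
  have "poly_op (map_poly cnj p) T (T y) = T (poly_op (map_poly cnj p) T y)"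
    using poly_op_mult[of "map_poly cnj p" "[:0, 1:]"] poly_op_mult[of "[:0, 1:]" "map_poly cnj p"]
    by (metis blinfun_apply_blinfun_compose mult.commute poly_op_X)
  then show ?case
    by (simp add: map_poly_pCons poly_op_pCons inner_add_left inner_add_right inner_scaleC_left
        adj pCons.IH)
qed simp

section \<open>Spectrum of a self-adjoint operator\<close>

text \<open>Otherwise \<open>B = z I - T\<close> is bounded below by \<open>e\<close>. Its adjoint
  is \<open>C\<close>, so \<open>C B\<close> is coercive and hence invertible. As \<open>B\<close>
  and \<open>C\<close> commute, \<open>B\<close> is invertible as well.\<close>

lemma approx_eigenvector:
  assumes z: "z \<in> spectrum T" and e: "e > 0"
  shows "\<exists>x. norm x = 1 \<and> norm (T x - z *\<^sub>C x) < e"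
proof (rule ccontr)
  assume neg: "\<not> ?thesis"
  define B C where "B = scalar_op z - T" and "C = scalar_op (cnj z) - T"
  have B: "B x = z *\<^sub>C x - T x" and C: "C x = cnj z *\<^sub>C x - T x" for x
    by (simp_all add: B_def C_def blinfun.diff_left scalar_op.rep_eq)
  have below: "e * norm x \<le> norm (B x)" for x
  proof (cases "x = 0")
    case False
    let ?u = "(1 / norm x) *\<^sub>R x"
    have "norm ?u = 1" using False by simp
    with neg have "e \<le> norm (B ?u)"
      by (simp add: B norm_minus_commute not_less)
    then show ?thesis
      using False by (simp add: blinfun.scaleR_right field_simps)
  qed simp
  have adjoint: "inner (C y) x = inner y (B x)" for x y
    by (simp add: B C inner_diff_left inner_diff_right inner_scaleC_left adj)
  have "boundedly_invertible (C o\<^sub>L B)"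
  proof (rule boundedly_invertible_coercive)
    show "e\<^sup>2 > 0" using e by simp
    show "e\<^sup>2 * (norm x)\<^sup>2 \<le> inner ((C o\<^sub>L B) x) x" for x
      using power_mono[OF below[of x], of 2] e
      by (simp add: adjoint power2_norm_eq_inner power_mult_distrib)
  qed
  moreover have "B o\<^sub>L C = C o\<^sub>L B"
    by (rule blinfun_eqI)
      (simp add: B C scaleC scaleC.diff_right scaleC_scaleC blinfun.diff_right mult.commute)
  ultimately have "boundedly_invertible B"
    using boundedly_invertible_of_commuting by metis
  with z show False
    by (simp add: spectrum_def B_def)
qed

lemma spectrum_real: "spectrum T \<subseteq> \<real>"
proof
  fix z assume z: "z \<in> spectrum T"
  have "\<bar>Im z\<bar> \<le> 0 + e" if e: "e > 0" for e
  proof -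
    obtain x where x: "norm x = 1" "norm (T x - z *\<^sub>C x) < e"
      using approx_eigenvector[OF z e] by blast
    \<comment> \<open>By symmetry this inner product vanishes, while \<open>z x\<close> contributes
      exactly \<open>Im z\<close>; hence \<open>Im z\<close> is bounded by the eigenvector
      error.\<close>
    have "inner (T x) (\<i> *\<^sub>C x) = - inner (T x) (\<i> *\<^sub>C x)"
      using inner_scaleC_left[of "\<i>" x "T x"]
      by (simp add: adj scaleC scaleC.minus_left inner_commute)
    moreover have "inner (z *\<^sub>C x) (\<i> *\<^sub>C x) = Im z"
    proof -
      have "cinner x x = complex_of_real 1"
        using x(1) cinner_commute[of x x] Re_cinner[of x x]
        by (simp add: complex_eq_iff norm_eq_1)
      then show ?thesis
        by (simp add: Re_cinner[symmetric] cinner_scaleC_left cinner_scaleC_right)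
    qed
    ultimately have "\<bar>Im z\<bar> = \<bar>inner (T x - z *\<^sub>C x) (\<i> *\<^sub>C x)\<bar>"
      by (simp add: inner_diff_left)
    also have "\<dots> \<le> norm (T x - z *\<^sub>C x) * norm (\<i> *\<^sub>C x)"
      by (rule Cauchy_Schwarz_ineq2)
    finally show ?thesis
      using x by (simp add: norm_scaleC)
  qed
  then have "Im z = 0"
    using field_le_epsilon[of "\<bar>Im z\<bar>" 0] by simp
  then show "z \<in> \<real>" by (simp add: complex_is_Real_iff)
qed

text \<open>Approximate eigenvectors bound \<open>cmod z\<close> by \<open>norm T\<close>, and those
  for a nearby spectral point serve for a limit point too.\<close>

lemma compact_spectrum: "compact (spectrum T)"
  unfolding compact_eq_bounded_closed
proof
  have "norm z \<le> norm T + e" if z: "z \<in> spectrum T" and e: "e > 0" for z e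
  proof -
    obtain x where x: "norm x = 1" "norm (T x - z *\<^sub>C x) < e"
      using approx_eigenvector[OF z e] by blast
    have "norm (z *\<^sub>C x) \<le> norm (T x) + norm (T x - z *\<^sub>C x)"
      using norm_triangle_sub[of "z *\<^sub>C x" "T x"] by (simp add: norm_minus_commute)
    then show ?thesis
      using x norm_blinfun[of T x] by (simp add: norm_scaleC)
  qed
  then show "bounded (spectrum T)"
    by (intro boundedI[of _ "norm T + 1"]) auto
  show "closed (spectrum T)"
    unfolding closed_sequential_limits
  proof clarify
    fix f z assume f: "\<forall>n. f n \<in> spectrum T" "f \<longlonglongrightarrow> z"
    show "z \<in> spectrum T"
    proof (rule approx_eigenvector_spectrum)
      fix e :: real assume "e > 0"
      then obtain n where n: "norm (f n - z) < e / 2"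
        using f(2) LIMSEQ_D[of f z "e / 2"] by auto
      obtain x where x: "norm x = 1" "norm (T x - f n *\<^sub>C x) < e / 2"
        using approx_eigenvector[of "f n" "e / 2"] f(1) \<open>e > 0\<close> by auto
      have "norm (T x - z *\<^sub>C x) \<le> norm (T x - f n *\<^sub>C x) + norm ((f n - z) *\<^sub>C x)"
        using norm_triangle_ineq[of "T x - f n *\<^sub>C x" "(f n - z) *\<^sub>C x"]
        by (simp add: scaleC.diff_left)
      then show "\<exists>x. norm x = 1 \<and> norm (T x - z *\<^sub>C x) < e"
        using x n by (intro exI[of _ x]) (simp add: norm_scaleC)
    qed
  qed
qed

section \<open>Norm of p(T)\<close>

text \<open>Over the complex numbers \<open>r\<close> splits into linear factors. Each root lies
  outside the spectrum, so \<open>r(T)\<close> is a product of invertible operators.\<close>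

lemma poly_op_invertible:
  assumes "r \<noteq> 0" "\<And>z. z \<in> spectrum T \<Longrightarrow> poly r z \<noteq> 0"
  shows "boundedly_invertible (poly_op r T)"
  using assms
proof (induction "degree r" arbitrary: r)
  case 0
  then obtain c where "r = [:c:]" "c \<noteq> 0"
    by (metis degree_eq_zeroE pCons_0_0)
  then show ?case by (simp add: poly_op_const boundedly_invertible_scalar_op)
next
  case (Suc n)
  then have "\<not> constant (poly r)" by (simp add: constant_degree)
  then obtain z where z: "poly r z = 0"
    using fundamental_theorem_of_algebra by blast
  then obtain q where q: "r = [:-z, 1:] * q"
    by (auto simp: poly_eq_0_iff_dvd dvd_def)
  have "q \<noteq> 0" using Suc.prems q by auto
  then have "degree r = Suc (degree q)"
    unfolding q by (subst degree_mult_eq) auto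
  with Suc.hyps(2) have "n = degree q" by simp
  then have "boundedly_invertible (poly_op q T)"
    using Suc.prems \<open>q \<noteq> 0\<close> by (intro Suc.hyps(1)) (auto simp: q)
  moreover have "boundedly_invertible (poly_op [:-z, 1:] T)"
  proof -
    have "poly_op [:-z, 1:] T = T - scalar_op z"
      by (rule blinfun_eqI)
        (simp add: poly_op_pCons scalar_op.rep_eq blinfun.diff_left scaleC.minus_left)
    moreover have "z \<notin> spectrum T" using z Suc.prems by blast
    ultimately show ?thesis
      by (simp add: spectrum_def boundedly_invertible_minus_commute)
  qed
  ultimately show ?case
    unfolding q poly_op_mult by (rule boundedly_invertible_compose[rotated])
qed

text \<open>Almost norming vectors of \<open>p(T)\<close> are approximate eigenvectors of \<open>p(T)\<^sup>* p(T)\<close>.\<close>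

lemma poly_op_norm_not_invertible:
  fixes x0 :: 'a
  assumes x0: "x0 \<noteq> 0"
  shows "\<not> boundedly_invertible
    (poly_op (map_poly cnj p * p - [:complex_of_real ((norm (poly_op p T))\<^sup>2):]) T)"
proof
  let ?P = "poly_op p T" and ?Q = "poly_op (map_poly cnj p) T"
  define M where "M = (norm ?P)\<^sup>2"
  assume "boundedly_invertible
    (poly_op (map_poly cnj p * p - [:complex_of_real ((norm ?P)\<^sup>2):]) T)"
  then obtain k where k: "k > 0" "\<And>x. k * norm x \<le>
      norm (poly_op (map_poly cnj p * p - [:complex_of_real M:]) T x)"
    unfolding M_def using boundedly_invertible_bounded_below by blast
  \<comment> \<open>\<open>?Q\<close> is the adjoint of \<open>?P\<close>, so its norm is at most
    that of \<open>?P\<close>.\<close>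
  have Qnorm: "norm (?Q y) \<le> norm ?P * norm y" for y
  proof (cases "?Q y = 0")
    case False
    have "norm (?Q y) * norm (?Q y) = inner (?P (?Q y)) y"
      unfolding poly_op_adj[of p "?Q y" y] by (metis power2_eq_square power2_norm_eq_inner)
    also have "\<dots> \<le> norm (?P (?Q y)) * norm y"
      by (rule norm_cauchy_schwarz)
    also have "\<dots> \<le> norm ?P * norm (?Q y) * norm y"
      by (intro mult_right_mono norm_blinfun) auto
    finally have "norm (?Q y) * norm (?Q y) \<le> (norm ?P * norm y) * norm (?Q y)"
      by (simp only: mult_ac)
    then show ?thesis
      by (rule mult_right_le_imp_le) (use False in simp)
  qed simp
  \<comment> \<open>Expand the square of \<open>norm (?N - M x)\<close>: the cross term is
    \<open>- 2 * M\<close> times the square of \<open>norm (?P x)\<close>, and the first square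
    gives back at most half of it.\<close>
  have bound: "k\<^sup>2 * (norm x)\<^sup>2 \<le> M\<^sup>2 * (norm x)\<^sup>2 - M * (norm (?P x))\<^sup>2" for x
  proof -
    let ?N = "?Q (?P x)"
    have "k\<^sup>2 * (norm x)\<^sup>2 \<le> (norm (?N - M *\<^sub>R x))\<^sup>2"
      using power_mono[OF k(2)[of x], of 2] k(1)
      by (simp add: poly_op_diff poly_op_mult poly_op_const blinfun.diff_left scalar_op.rep_eq
          scaleC_of_real power_mult_distrib)
    also have "\<dots> = (norm ?N)\<^sup>2 - 2 * M * inner ?N x + M\<^sup>2 * (norm x)\<^sup>2"
      unfolding power2_norm_eq_inner
      by (simp add: inner_diff_left inner_diff_right inner_commute power2_eq_square)
    also have "inner ?N x = (norm (?P x))\<^sup>2"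
      by (metis inner_commute poly_op_adj power2_norm_eq_inner)
    also have "(norm ?N)\<^sup>2 \<le> M * (norm (?P x))\<^sup>2"
      using power_mono[OF Qnorm[of "?P x"], of 2] by (simp add: M_def power_mult_distrib)
    finally show ?thesis by simp
  qed
  show False
  proof (cases "M = 0")
    case True
    with bound[of x0] k(1) x0 show False
      by (simp add: power2_eq_square mult_le_0_iff)
  next
    case False
    then have M: "M > 0" by (simp add: M_def)
    \<comment> \<open>Dividing by \<open>M\<close> gives a bound on \<open>?P\<close> strictly below
      its own norm.\<close>
    have *: "(norm (?P x))\<^sup>2 \<le> (M - k\<^sup>2 / M) * (norm x)\<^sup>2" for x
      using bound[of x] M by (simp add: field_simps power2_eq_square)
    have "0 \<le> (M - k\<^sup>2 / M) * (norm x0)\<^sup>2"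
      using *[of x0] by (meson order_trans zero_le_power2)
    then have nn: "0 \<le> M - k\<^sup>2 / M"
      using x0 by (simp add: zero_le_mult_iff)
    have "norm ?P \<le> sqrt (M - k\<^sup>2 / M)"
    proof (rule norm_blinfun_bound)
      show "norm (?P x) \<le> sqrt (M - k\<^sup>2 / M) * norm x" for x
        using real_le_rsqrt[OF *[of x]] by (simp add: real_sqrt_mult)
    qed (use nn in simp)
    then have "M \<le> M - k\<^sup>2 / M"
      using nn unfolding M_def by (metis norm_ge_zero power_mono real_sqrt_pow2)
    with k(1) M show False by (simp add: field_simps)
  qed
qed

lemma cnj_spectrum: "z \<in> spectrum T \<Longrightarrow> cnj z = z"
  using spectrum_real by (simp add: Reals_cnj_iff subset_iff)

lemma norm_poly_op_attained:
  fixes x0 :: 'a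
  assumes "x0 \<noteq> 0"
  shows "\<exists>z\<in>spectrum T. norm (poly_op p T) = cmod (poly p z)"
proof -
  define r where "r = (\<lambda>p. map_poly cnj p * p - [:complex_of_real ((norm (poly_op p T))\<^sup>2):])"
  have root: "\<exists>z\<in>spectrum T. poly (r p) z = 0" if "r p \<noteq> 0" for p
    using poly_op_invertible[OF that] poly_op_norm_not_invertible[OF assms, of p]
    unfolding r_def by blast
  \<comment> \<open>The identity polynomial shows that the spectrum is nonempty. This settles the
    case \<open>r p = 0\<close>, in which every spectral point is a root.\<close>
  have "r [:0, 1:] \<noteq> 0"
    by (simp add: r_def map_poly_pCons)
  then obtain z0 where "z0 \<in> spectrum T" using root by blast
  then obtain z where z: "z \<in> spectrum T" "poly (r p) z = 0"
    using root[of p] by (metis poly_0)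
  then have "cnj (poly p z) * poly p z = complex_of_real ((norm (poly_op p T))\<^sup>2)"
    by (simp add: r_def cnj_spectrum)
  then have "complex_of_real ((cmod (poly p z))\<^sup>2) = complex_of_real ((norm (poly_op p T))\<^sup>2)"
    unfolding complex_norm_square by (simp only: mult.commute[of "poly p z"])
  then have "(cmod (poly p z))\<^sup>2 = (norm (poly_op p T))\<^sup>2"
    unfolding of_real_eq_iff .
  then have "norm (poly_op p T) = cmod (poly p z)"
    by (rule power2_eq_imp_eq[symmetric]) auto
  with z show ?thesis by blast
qed

text \<open>The zero space is separated out because its operators have empty spectrum, so the norm
  is not attained there.\<close>

lemma norm_poly_op_le:
  assumes "M \<ge> 0" "\<And>z. z \<in> spectrum T \<Longrightarrow> cmod (poly p z) \<le> M"
  shows "norm (poly_op p T) \<le> M"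
proof (cases "\<exists>x0::'a. x0 \<noteq> 0")
  case True
  then show ?thesis using norm_poly_op_attained assms by metis
next
  case False
  then have "norm (poly_op p T) \<le> 0"
    by (intro norm_blinfun_bound) auto
  then show ?thesis using assms by simp
qed

section \<open>Existence and properties of the continuous functional calculus\<close>

lemma poly_op_tendsto_0:
  assumes "uniform_limit (spectrum T) (\<lambda>n. poly (p n)) (\<lambda>_. 0) sequentially"
  shows "(\<lambda>n. poly_op (p n) T) \<longlonglongrightarrow> 0"
proof (rule tendstoI)
  fix e :: real assume "e > 0"
  then have "e / 2 > 0" by simp
  from uniform_limitD[OF assms this]
  show "\<forall>\<^sub>F n in sequentially. dist (poly_op (p n) T) 0 < e"
  proof eventually_elim
    case (elim n)
    have "norm (poly_op (p n) T) \<le> e / 2"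
      by (rule norm_poly_op_le) (use \<open>e > 0\<close> elim in \<open>auto simp: less_imp_le\<close>)
    then show ?case using \<open>e > 0\<close> by simp
  qed
qed

lemma poly_op_convergent:
  assumes "uniform_limit (spectrum T) (\<lambda>n. poly (p n)) g sequentially"
  shows "convergent (\<lambda>n. poly_op (p n) T)"
proof -
  have "Cauchy (\<lambda>n. poly_op (p n) T)"
  proof (rule metric_CauchyI)
    fix e :: real assume e: "e > 0"
    have "uniformly_Cauchy_on (spectrum T) (\<lambda>n. poly (p n))"
      using assms uniformly_convergent_Cauchy uniformly_convergent_on_def by blast
    then obtain N where N: "\<And>z m n. z \<in> spectrum T \<Longrightarrow> m \<ge> N \<Longrightarrow> n \<ge> N \<Longrightarrow>
        dist (poly (p m) z) (poly (p n) z) < e / 2"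
      using e unfolding uniformly_Cauchy_on_def by (meson half_gt_zero)
    have "norm (poly_op (p m - p n) T) \<le> e / 2" if "m \<ge> N" "n \<ge> N" for m n
      by (rule norm_poly_op_le)
        (use e N that in \<open>auto simp: dist_norm less_imp_le\<close>)
    then show "\<exists>N. \<forall>m\<ge>N. \<forall>n\<ge>N. dist (poly_op (p m) T) (poly_op (p n) T) < e"
      using e by (intro exI[of _ N]) (force simp: dist_norm poly_op_diff)
  qed
  then show ?thesis by (rule Cauchy_convergent)
qed

text \<open>This justifies the definite description. Two approximating sequences differ by
  polynomials tending uniformly to 0, so their operator limits agree; the given sequence
  \<open>p\<close> makes the common limit unique.\<close>

lemma cont_fun_calc_limit:
  assumes g: "continuous_on (spectrum T) g"
    and p: "uniform_limit (spectrum T) (\<lambda>n. poly (p n)) g sequentially"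
  shows "(\<lambda>n. poly_op (p n) T) \<longlonglongrightarrow> cont_fun_calc g T"
proof -
  obtain S where S: "(\<lambda>n. poly_op (p n) T) \<longlonglongrightarrow> S"
    using poly_op_convergent[OF p] by (auto simp: convergent_def)
  have all: "(\<lambda>n. poly_op (q n) T) \<longlonglongrightarrow> S"
    if q: "uniform_limit (spectrum T) (\<lambda>n. poly (q n)) g sequentially" for q
  proof -
    have "uniform_limit (spectrum T) (\<lambda>n. poly (q n - p n)) (\<lambda>_. 0) sequentially"
      using uniform_limit_minus[OF q p] by (simp add: poly_diff_fun)
    then have "(\<lambda>n. poly_op (q n - p n) T) \<longlonglongrightarrow> 0" by (rule poly_op_tendsto_0)
    from tendsto_add[OF this S] show ?thesis by (simp add: poly_op_diff)
  qed
  have "cont_fun_calc g T = S"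
    unfolding cont_fun_calc_def
  proof (rule the_equality)
    fix S' assume "\<forall>p. uniform_limit (spectrum T) (\<lambda>n. poly (p n)) g sequentially \<longrightarrow>
      (\<lambda>n. poly_op (p n) T) \<longlonglongrightarrow> S'"
    with p S show "S' = S" using LIMSEQ_unique by blast
  qed (use all in blast)
  then show ?thesis using S by simp
qed

lemma approximating_polys:
  assumes "continuous_on (spectrum T) g"
  obtains p where "uniform_limit (spectrum T) (\<lambda>n. poly (p n)) g sequentially"
    "(\<lambda>n. poly_op (p n) T) \<longlonglongrightarrow> cont_fun_calc g T"
  using Weierstrass_complex_poly[OF compact_spectrum spectrum_real assms]
    cont_fun_calc_limit[OF assms] by metis

text \<open>The inverse is the limit of \<open>r\<^sub>n(T)\<close> with \<open>r\<^sub>n\<close> approximating \<open>1 / d\<close>.\<close>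

lemma limit_poly_op_invertible:
  assumes p: "uniform_limit (spectrum T) (\<lambda>n. poly (p n)) d sequentially"
    and lim: "(\<lambda>n. poly_op (p n) T) \<longlonglongrightarrow> D"
    and d: "continuous_on (spectrum T) d" "\<And>z. z \<in> spectrum T \<Longrightarrow> d z \<noteq> 0"
  shows "boundedly_invertible D"
proof -
  let ?g = "\<lambda>z. inverse (d z)"
  have g: "continuous_on (spectrum T) ?g"
    using d by (intro continuous_intros) auto
  obtain r where r: "uniform_limit (spectrum T) (\<lambda>n. poly (r n)) ?g sequentially"
    "(\<lambda>n. poly_op (r n) T) \<longlonglongrightarrow> cont_fun_calc ?g T"
    using approximating_polys[OF g] .
  have bdd: "bounded (f ` spectrum T)" if "continuous_on (spectrum T) f" for f :: "complex \<Rightarrow> complex"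
    using compact_continuous_image[OF that compact_spectrum] by (rule compact_imp_bounded)
  have "uniform_limit (spectrum T) (\<lambda>n z. poly (r n) z * poly (p n) z) (\<lambda>z. ?g z * d z) sequentially"
    by (intro uniform_lim_mult r p bdd g d)
  then have "uniform_limit (spectrum T) (\<lambda>n. poly (r n * p n)) (\<lambda>_. 1) sequentially"
    by (rule uniform_limit_cong'[THEN iffD1, rotated 2]) (auto simp: d)
  then have "uniform_limit (spectrum T) (\<lambda>n. poly (r n * p n - 1)) (\<lambda>_. 0) sequentially"
    using uniform_limit_minus[where m = "\<lambda>_. 1", OF _ uniform_limit_const]
    by (fastforce simp: poly_diff_fun)
  then have "(\<lambda>n. poly_op (r n * p n - 1) T) \<longlonglongrightarrow> 0"
    by (rule poly_op_tendsto_0)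
  moreover have "poly_op 1 T = id_blinfun"
    by (rule blinfun_eqI) (simp add: one_pCons poly_op_const scalar_op.rep_eq)
  ultimately have lim1: "(\<lambda>n. poly_op (r n * p n) T) \<longlonglongrightarrow> id_blinfun"
    by (simp add: poly_op_diff LIM_zero_iff)
  have "(\<lambda>n. poly_op (r n * p n) T) \<longlonglongrightarrow> (cont_fun_calc ?g T o\<^sub>L D)"
    unfolding poly_op_mult by (intro tendsto_intros bounded_bilinear.tendsto[OF bounded_bilinear_blinfun_compose] r lim)
  moreover have "(\<lambda>n. poly_op (r n * p n) T) \<longlonglongrightarrow> (D o\<^sub>L cont_fun_calc ?g T)"
    unfolding mult.commute[of "r _"] poly_op_mult by (intro bounded_bilinear.tendsto[OF bounded_bilinear_blinfun_compose] r lim)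
  ultimately show ?thesis
    using lim1 LIMSEQ_unique unfolding boundedly_invertible_def by blast
qed

text \<open>\<open>p - p(z)\<close> is divisible by \<open>X - z\<close>; the norm of the quotient
  at \<open>T\<close> controls the error.\<close>

lemma poly_op_approx_eigen:
  obtains K where "K > 0" "\<And>x. norm (poly_op p T x - poly p z *\<^sub>C x) \<le> K * norm (T x - z *\<^sub>C x)"
proof -
  have "poly (p - [:poly p z:]) z = 0" by simp
  then obtain q where q: "p - [:poly p z:] = q * [:-z, 1:]"
    by (metis dvd_def mult.commute poly_eq_0_iff_dvd)
  have "norm (poly_op p T x - poly p z *\<^sub>C x) \<le> (norm (poly_op q T) + 1) * norm (T x - z *\<^sub>C x)" for x
  proof -
    have "poly_op (p - [:poly p z:]) T x = poly_op q T (poly_op [:-z, 1:] T x)"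
      by (simp only: q poly_op_mult blinfun_apply_blinfun_compose)
    then have "poly_op p T x - poly p z *\<^sub>C x = poly_op q T (T x - z *\<^sub>C x)"
      by (simp add: poly_op_diff poly_op_const blinfun.diff_left scalar_op.rep_eq poly_op_pCons
          scaleC.minus_left)
    then have "norm (poly_op p T x - poly p z *\<^sub>C x) \<le> norm (poly_op q T) * norm (T x - z *\<^sub>C x)"
      using norm_blinfun by metis
    also have "\<dots> \<le> (norm (poly_op q T) + 1) * norm (T x - z *\<^sub>C x)"
      by (intro mult_right_mono) auto
    finally show ?thesis .
  qed
  then show ?thesis
    using that[of "norm (poly_op q T) + 1"] by (simp add: add_nonneg_pos)
qed

text \<open>Three errors of \<open>e / 3\<close>: \<open>p(T) x\<close> against
  \<open>p(z) x\<close>, \<open>p(z)\<close> against \<open>g z\<close>, and \<open>p(T)\<close>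
  against \<open>g(T)\<close>. The polynomial is fixed first, since the constant \<open>K\<close>
  that determines the radius depends on it.\<close>

lemma cont_fun_calc_approx_eigen:
  assumes g: "continuous_on (spectrum T) g" and z: "z \<in> spectrum T" and e: "e > 0"
  obtains \<delta> where "\<delta> > 0"
    "\<And>x. norm x = 1 \<Longrightarrow> norm (T x - z *\<^sub>C x) < \<delta> \<Longrightarrow> norm (cont_fun_calc g T x - g z *\<^sub>C x) < e"
proof -
  let ?U = "cont_fun_calc g T"
  obtain p where p: "uniform_limit (spectrum T) (\<lambda>n. poly (p n)) g sequentially"
    "(\<lambda>n. poly_op (p n) T) \<longlonglongrightarrow> ?U"
    using approximating_polys[OF g] .
  have e3: "e / 3 > 0" using e by simp
  have "\<forall>\<^sub>F n in sequentially. cmod (poly (p n) z - g z) < e / 3 \<and> norm (poly_op (p n) T - ?U) < e / 3"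
    using uniform_limitD[OF p(1) e3] tendstoD[OF p(2) e3]
    by eventually_elim (use z in \<open>auto simp: dist_norm\<close>)
  then obtain n where n: "cmod (poly (p n) z - g z) < e / 3" "norm (poly_op (p n) T - ?U) < e / 3"
    using eventually_happens'[OF sequentially_bot] by blast
  let ?P = "poly_op (p n) T"
  obtain K where K: "K > 0" "\<And>x. norm (?P x - poly (p n) z *\<^sub>C x) \<le> K * norm (T x - z *\<^sub>C x)"
    using poly_op_approx_eigen[of "p n" z] by blast
  show ?thesis
  proof (rule that[of "e / 3 / K"])
    show "e / 3 / K > 0" using e K by simp
    fix x assume x: "norm x = 1" "norm (T x - z *\<^sub>C x) < e / 3 / K"
    have 1: "norm (?P x - poly (p n) z *\<^sub>C x) < e / 3"
    proof -
      have "K * norm (T x - z *\<^sub>C x) < K * (e / 3 / K)"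
        using x K by (intro mult_strict_left_mono) auto
      then show ?thesis using K(2)[of x] K(1) by simp
    qed
    have 2: "norm ((?P - ?U) x) < e / 3"
      using norm_blinfun[of "?P - ?U" x] x n by simp
    have 3: "norm ((poly (p n) z - g z) *\<^sub>C x) < e / 3"
      using x n by (simp add: norm_scaleC)
    have "?U x - g z *\<^sub>C x =
        ((?P x - poly (p n) z *\<^sub>C x) + (poly (p n) z - g z) *\<^sub>C x) - (?P - ?U) x"
      by (simp add: blinfun.diff_left scaleC.diff_left)
    then have "norm (?U x - g z *\<^sub>C x) \<le>
        norm (?P x - poly (p n) z *\<^sub>C x) + norm ((poly (p n) z - g z) *\<^sub>C x) + norm ((?P - ?U) x)"
      by (metis (no_types) add_right_mono norm_triangle_ineq norm_triangle_ineq4 order_trans)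
    then show "norm (?U x - g z *\<^sub>C x) < e" using 1 2 3 by linarith
  qed
qed

end

section \<open>Antilinear self-adjoint operators\<close>

locale antilinear_self_adjoint_operator =
  fixes A :: "'a::complex_hilbert_space \<Rightarrow>\<^sub>L 'a"
  assumes antilin: "A (c *\<^sub>C x) = cnj c *\<^sub>C A x"
    and adj: "inner (A x) y = inner x (A y)"
begin

sublocale square: self_adjoint_operator "A o\<^sub>L A"
  by unfold_locales (simp_all add: antilin adj)

abbreviation T where "T \<equiv> A o\<^sub>L A"

lemma A_poly_op: "A (poly_op p T x) = poly_op (map_poly cnj p) T (A x)"
  by (induction p) (simp_all add: map_poly_pCons square.poly_op_pCons antilin blinfun.add_right)

text \<open>For a unit approximate eigenvector, \<open>inner (T x) x\<close> is the square of
  \<open>norm (A x)\<close> and is close to \<open>Re t\<close>.\<close>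

lemma spectrum_square_nonneg:
  assumes t: "t \<in> spectrum T"
  shows "0 \<le> Re t"
proof -
  have "0 \<le> Re t + e" if e: "e > 0" for e
  proof -
    obtain x where x: "norm x = 1" "norm (T x - t *\<^sub>C x) < e"
      using square.approx_eigenvector[OF t e] by blast
    have "t = complex_of_real (Re t)"
      using square.spectrum_real t by (auto simp: Reals_def)
    then have "t *\<^sub>C x = Re t *\<^sub>R x"
      by (metis scaleC_of_real)
    then have "inner (T x - t *\<^sub>C x) x = (norm (A x))\<^sup>2 - Re t"
      using x(1) by (simp add: inner_diff_left adj power2_norm_eq_inner norm_eq_1)
    moreover have "\<bar>inner (T x - t *\<^sub>C x) x\<bar> \<le> norm (T x - t *\<^sub>C x) * norm x"
      by (rule Cauchy_Schwarz_ineq2)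
    ultimately have "\<bar>(norm (A x))\<^sup>2 - Re t\<bar> < e" using x by simp
    then show ?thesis using zero_le_power2[of "norm (A x)"] by linarith
  qed
  then show ?thesis by (rule field_le_epsilon)
qed

text \<open>If \<open>A x\<close> is not close to \<open>s x\<close>, then \<open>y = A x - s x\<close> satisfies
  \<open>A y + s y = A\<^sup>2 x - s\<^sup>2 x \<approx> 0\<close>, and multiplying \<open>y\<close> by \<open>\<i>\<close> turns \<open>-s\<close> into \<open>s\<close>.\<close>

lemma approx_eigenvector_real:
  assumes s: "complex_of_real (s\<^sup>2) \<in> spectrum T" and e: "e > 0"
  shows "\<exists>w. norm w = 1 \<and> norm (A w - s *\<^sub>R w) < e"
proof -
  \<comment> \<open>Accuracy \<open>e * e\<close> is requested because normalising \<open>y\<close>,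
    with \<open>norm y \<ge> e\<close>, costs a factor \<open>1 / e\<close>.\<close>
  obtain x where x: "norm x = 1" "norm (T x - complex_of_real (s\<^sup>2) *\<^sub>C x) < e * e"
    using square.approx_eigenvector[OF s, of "e * e"] e by auto
  define y where "y = A x - s *\<^sub>R x"
  show ?thesis
  proof (cases "norm y < e")
    case True
    then show ?thesis using x by (auto simp: y_def)
  next
    case False
    then have y: "norm y \<ge> e" "y \<noteq> 0" using e by auto
    have "A y + s *\<^sub>R y = T x - complex_of_real (s\<^sup>2) *\<^sub>C x"
      unfolding scaleC_of_real
      by (simp add: y_def blinfun.diff_right blinfun.scaleR_right scaleR_diff_right power2_eq_square)
    then have small: "norm (A y + s *\<^sub>R y) < e * e" using x by simp
    define w where "w = (1 / norm y) *\<^sub>R (\<i> *\<^sub>C y)"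
    have "A w - s *\<^sub>R w = (1 / norm y) *\<^sub>R (- (\<i> *\<^sub>C (A y + s *\<^sub>R y)))"
      by (simp add: w_def antilin blinfun.scaleR_right scaleC.add_right scaleC.minus_left
          scaleC.scaleR_right scaleR_diff_right scaleR_add_right)
    then have "norm (A w - s *\<^sub>R w) = norm (A y + s *\<^sub>R y) / norm y"
      by (simp add: norm_scaleC)
    also have "\<dots> < e * e / norm y"
      using small y by (intro divide_strict_right_mono) auto
    also have "\<dots> \<le> e * e / e"
      using y e by (intro divide_left_mono) auto
    finally have "norm (A w - s *\<^sub>R w) < e" using e by simp
    moreover have "norm w = 1" using y by (simp add: w_def norm_scaleC)
    ultimately show ?thesis by blast
  qed
qed

text \<open>With \<open>m\<close> a square root of the phase of \<open>z\<close>, antilinearity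
  gives \<open>A (cnj m w) = m A w\<close>, close to \<open>m |z| w = z cnj m w\<close>. So
  approximate eigenvalues of \<open>A\<close> may be rotated freely.\<close>

lemma approx_eigenvector:
  assumes z: "complex_of_real ((cmod z)\<^sup>2) \<in> spectrum T" and e: "e > 0"
  shows "\<exists>w. norm w = 1 \<and> norm (A w - z *\<^sub>C w) < e"
proof -
  obtain w where w: "norm w = 1" "norm (A w - cmod z *\<^sub>R w) < e"
    using approx_eigenvector_real[OF z e] by blast
  define m where "m = cis (Arg z / 2)"
  have m: "cmod m = 1" "m * cnj m = 1"
    by (simp_all add: m_def cis_cnj cis_mult)
  have zm: "z = complex_of_real (cmod z) * (m * m)"
    using rcis_cmod_Arg[of z] by (simp add: m_def cis_mult rcis_def)
  have "z * cnj m = m * complex_of_real (cmod z)"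
    by (subst zm) (simp add: m(2) mult.assoc mult.commute)
  then have "z *\<^sub>C cnj m *\<^sub>C w = m *\<^sub>C cmod z *\<^sub>R w"
    by (simp add: scaleC_scaleC scaleC_of_real[symmetric])
  then have "A (cnj m *\<^sub>C w) - z *\<^sub>C cnj m *\<^sub>C w = m *\<^sub>C (A w - cmod z *\<^sub>R w)"
    by (simp add: antilin scaleC.diff_right)
  then have "norm (A (cnj m *\<^sub>C w) - z *\<^sub>C cnj m *\<^sub>C w) < e"
    using w m by (simp add: norm_scaleC)
  moreover have "norm (cnj m *\<^sub>C w) = 1" using w m by (simp add: norm_scaleC)
  ultimately show ?thesis by blast
qed

text \<open>For the forward direction, \<open>z I - A\<close> and \<open>cnj z I + A\<close> commute
  with product \<open>|z|^2 I - T\<close>: antilinearity cancels the terms linear in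
  \<open>A\<close>.\<close>

lemma spectrum_iff: "z \<in> spectrum A \<longleftrightarrow> complex_of_real ((cmod z)\<^sup>2) \<in> spectrum T"
proof
  assume "complex_of_real ((cmod z)\<^sup>2) \<in> spectrum T"
  then show "z \<in> spectrum A"
    by (rule approx_eigenvector_spectrum[OF approx_eigenvector])
next
  assume z: "z \<in> spectrum A"
  let ?c = "complex_of_real ((cmod z)\<^sup>2)"
  define B C where "B = scalar_op z - A" and "C = scalar_op (cnj z) + A"
  have "B o\<^sub>L C = scalar_op ?c - T" "C o\<^sub>L B = scalar_op ?c - T"
    by (rule blinfun_eqI, simp add: B_def C_def blinfun.diff_left blinfun.add_left blinfun.diff_right
        blinfun.add_right scalar_op.rep_eq antilin scaleC_scaleC scaleC.add_right scaleC.diff_right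
        complex_norm_square mult.commute del: of_real_power)+
  then have "boundedly_invertible B" if "?c \<notin> spectrum T"
    using that boundedly_invertible_of_commuting unfolding spectrum_def by blast
  with z show "?c \<in> spectrum T"
    by (auto simp: spectrum_def B_def)
qed

section \<open>Spectrum of biradial functions of A\<close>

text \<open>Here \<open>L K = K L = |a|\<^sup>2 - |b|\<^sup>2 A\<^sup>2\<close>: the terms of odd degree in \<open>A\<close> cancel because \<open>A\<close>
  conjugates the functions of \<open>A\<^sup>2\<close> that it passes.\<close>

lemma biradial_poly_product:
  fixes a b :: "complex poly"
  defines "K \<equiv> poly_op a T - (poly_op b T o\<^sub>L A)"
    and "L \<equiv> poly_op (map_poly cnj a) T + (poly_op b T o\<^sub>L A)"
    and "D \<equiv> poly_op (a * map_poly cnj a - [:0, 1:] * (b * map_poly cnj b)) T"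
  shows "K o\<^sub>L L = D" and "L o\<^sub>L K = D"
proof -
  have cnj2: "map_poly cnj (map_poly cnj p) = p" for p
    by (rule poly_eqI) (simp add: coeff_map_poly)
  have comp: "poly_op p T (poly_op q T x) = poly_op (p * q) T x" for p q x
    by (simp add: square.poly_op_mult)
  \<comment> \<open>Placing the factor \<open>X\<close> innermost turns it into
    \<open>A (A x)\<close>, the form that appears when \<open>K L\<close> and \<open>L K\<close> are
    expanded.\<close>
  have D: "D x = poly_op (a * map_poly cnj a) T x - poly_op (b * map_poly cnj b) T (A (A x))" for x
  proof -
    have "poly_op ([:0, 1:] * (b * map_poly cnj b)) T x
        = poly_op (b * map_poly cnj b) T (poly_op [:0, 1:] T x)"
      by (simp only: comp mult.commute)
    then show ?thesis
      unfolding D_def poly_op_diff blinfun.diff_left by (simp only: square.poly_op_X) simp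
  qed
  show "K o\<^sub>L L = D"
    by (rule blinfun_eqI) (simp add: D, simp add: K_def L_def blinfun.diff_left blinfun.add_left
        blinfun.add_right A_poly_op comp cnj2 mult.commute)
  show "L o\<^sub>L K = D"
    by (rule blinfun_eqI) (simp add: D, simp add: K_def L_def blinfun.diff_left blinfun.add_left
        blinfun.diff_right A_poly_op comp cnj2 mult.commute)
qed

text \<open>The polynomial identities \<open>K L = D = L K\<close> pass to the limit along
  approximations of \<open>u\<close> and \<open>v\<close>.\<close>

lemma biradial_invertible:
  assumes u: "continuous_on (spectrum T) u" and v: "continuous_on (spectrum T) v"
    and nz: "\<And>t. t \<in> spectrum T \<Longrightarrow> (c - u t) * cnj (c - u t) - t * (v t * cnj (v t)) \<noteq> 0"
  shows "boundedly_invertible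
    (scalar_op c - (cont_fun_calc u T + (cont_fun_calc v T o\<^sub>L A)))"
proof -
  obtain p where p: "uniform_limit (spectrum T) (\<lambda>n. poly (p n)) u sequentially"
    "(\<lambda>n. poly_op (p n) T) \<longlonglongrightarrow> cont_fun_calc u T"
    using square.approximating_polys[OF u] .
  obtain q where q: "uniform_limit (spectrum T) (\<lambda>n. poly (q n)) v sequentially"
    "(\<lambda>n. poly_op (q n) T) \<longlonglongrightarrow> cont_fun_calc v T"
    using square.approximating_polys[OF v] .
  define a where "a n = [:c:] - p n" for n
  let ?K = "scalar_op c - (cont_fun_calc u T + (cont_fun_calc v T o\<^sub>L A))"
  let ?d = "\<lambda>t. (c - u t) * cnj (c - u t) - t * (v t * cnj (v t))"
  let ?D = "\<lambda>n. a n * map_poly cnj (a n) - [:0, 1:] * (q n * map_poly cnj (q n))"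
  \<comment> \<open>Conjugating coefficients conjugates values because the spectrum is real.\<close>
  have cnj_on: "poly (map_poly cnj r) t = cnj (poly r t)" if "t \<in> spectrum T" for r t
    using square.cnj_spectrum[OF that] by simp
  have a: "uniform_limit (spectrum T) (\<lambda>n. poly (a n)) (\<lambda>t. c - u t) sequentially"
    unfolding a_def using uniform_limit_minus[OF uniform_limit_const p(1)]
    by (simp add: poly_diff_fun)
  have ca: "uniform_limit (spectrum T) (\<lambda>n. poly (map_poly cnj (a n))) (\<lambda>t. cnj (c - u t)) sequentially"
    by (rule uniform_limit_cong'[THEN iffD1, OF _ _ bounded_linear_uniform_limit_intros(3)[OF a]])
      (simp_all only: cnj_on)
  have cq: "uniform_limit (spectrum T) (\<lambda>n. poly (map_poly cnj (q n))) (\<lambda>t. cnj (v t)) sequentially"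
    by (rule uniform_limit_cong'[THEN iffD1, OF _ _ bounded_linear_uniform_limit_intros(3)[OF q(1)]])
      (simp_all only: cnj_on)
  have bdd: "bounded (f ` spectrum T)" if "continuous_on (spectrum T) f" for f :: "complex \<Rightarrow> complex"
    using compact_continuous_image[OF that square.compact_spectrum] by (rule compact_imp_bounded)
  have "uniform_limit (spectrum T)
      (\<lambda>n t. poly (a n) t * poly (map_poly cnj (a n)) t
        - t * (poly (q n) t * poly (map_poly cnj (q n)) t)) ?d sequentially"
    by (intro uniform_limit_minus uniform_lim_mult a ca cq q(1) bdd continuous_intros u v
        uniform_limit_const)
  then have unif: "uniform_limit (spectrum T) (\<lambda>n. poly (?D n)) ?d sequentially"
    by (rule uniform_limit_cong'[THEN iffD1, rotated 2]) simp_all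
  have "(\<lambda>n. poly_op (a n) T) \<longlonglongrightarrow> scalar_op c - cont_fun_calc u T"
    unfolding a_def poly_op_diff square.poly_op_const by (intro tendsto_intros p)
  moreover have qA: "(\<lambda>n. poly_op (q n) T o\<^sub>L A) \<longlonglongrightarrow> (cont_fun_calc v T o\<^sub>L A)"
    by (intro bounded_bilinear.tendsto[OF bounded_bilinear_blinfun_compose] q tendsto_const)
  ultimately have K: "(\<lambda>n. poly_op (a n) T - (poly_op (q n) T o\<^sub>L A)) \<longlonglongrightarrow> ?K"
    unfolding diff_diff_eq[symmetric] by (rule tendsto_diff)
  \<comment> \<open>Only convergence matters: \<open>L\<close> serves as a cofactor of
    \<open>?K\<close> and is never identified.\<close>
  obtain L0 where "(\<lambda>n. poly_op (map_poly cnj (a n)) T) \<longlonglongrightarrow> L0"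
    using square.poly_op_convergent[OF ca] by (auto simp: convergent_def)
  then obtain L where L: "(\<lambda>n. poly_op (map_poly cnj (a n)) T + (poly_op (q n) T o\<^sub>L A)) \<longlonglongrightarrow> L"
    using tendsto_add[OF _ qA] by blast
  have KL: "(\<lambda>n. poly_op (?D n) T) \<longlonglongrightarrow> (?K o\<^sub>L L)"
    using bounded_bilinear.tendsto[OF bounded_bilinear_blinfun_compose K L] by (simp only: biradial_poly_product)
  have LK: "(\<lambda>n. poly_op (?D n) T) \<longlonglongrightarrow> (L o\<^sub>L ?K)"
    using bounded_bilinear.tendsto[OF bounded_bilinear_blinfun_compose L K] by (simp only: biradial_poly_product)
  have "boundedly_invertible (?K o\<^sub>L L)"
    by (rule square.limit_poly_op_invertible[OF unif KL])
      (use nz in \<open>auto intro!: continuous_intros u v\<close>)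
  then show ?thesis
    using boundedly_invertible_of_commuting LIMSEQ_unique[OF KL LK] by metis
qed

text \<open>With \<open>r = A x - z x\<close>, the error of f(A) at \<open>x\<close> splits into
  \<open>U x - u x\<close>, \<open>V r\<close> and \<open>z (V x - v x)\<close>. The vector
  \<open>x\<close> is chosen to make all three small.\<close>

lemma biradial_spectrum_subset:
  assumes u: "continuous_on (spectrum T) u" and v: "continuous_on (spectrum T) v"
    and z: "z \<in> spectrum A"
  defines "t \<equiv> complex_of_real ((cmod z)\<^sup>2)"
  shows "u t + v t * z \<in> spectrum (cont_fun_calc u T + (cont_fun_calc v T o\<^sub>L A))"
proof (rule approx_eigenvector_spectrum)
  fix e :: real assume e: "e > 0"
  let ?U = "cont_fun_calc u T" and ?V = "cont_fun_calc v T"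
  have t: "t \<in> spectrum T" using z by (simp only: t_def spectrum_iff)
  \<comment> \<open>Complex linearity of \<open>?V\<close> is inherited from the polynomials and
    turns \<open>V (z x)\<close> into \<open>z V x\<close>.\<close>
  have V_scaleC: "?V (k *\<^sub>C x) = k *\<^sub>C ?V x" for k x
  proof -
    obtain q where "(\<lambda>n. poly_op (q n) T) \<longlonglongrightarrow> ?V"
      using square.approximating_polys[OF v] by blast
    then have *: "(\<lambda>n. poly_op (q n) T y) \<longlonglongrightarrow> ?V y" for y
      by (intro blinfun.tendsto tendsto_const)
    have "(\<lambda>n. poly_op (q n) T (k *\<^sub>C x)) \<longlonglongrightarrow> k *\<^sub>C ?V x"
      unfolding square.poly_op_scaleC by (intro scaleC.tendsto tendsto_const *)
    then show ?thesis using * LIMSEQ_unique by blast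
  qed
  \<comment> \<open>A single constant dominating every factor that multiplies an error
    below.\<close>
  define k where "k = norm A + cmod z + norm ?V + 1"
  have k: "k > 0" "cmod z \<le> k" "norm ?V \<le> k" "norm A + cmod z \<le> k"
    by (simp_all add: k_def add_nonneg_pos)
  have e': "e / 3 > 0" "e / 3 / k > 0" using e k by simp_all
  obtain d1 where d1: "d1 > 0"
    "\<And>x. norm x = 1 \<Longrightarrow> norm (T x - t *\<^sub>C x) < d1 \<Longrightarrow> norm (?U x - u t *\<^sub>C x) < e / 3"
    using square.cont_fun_calc_approx_eigen[OF u t e'(1)] by blast
  obtain d2 where d2: "d2 > 0"
    "\<And>x. norm x = 1 \<Longrightarrow> norm (T x - t *\<^sub>C x) < d2 \<Longrightarrow> norm (?V x - v t *\<^sub>C x) < e / 3 / k"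
    using square.cont_fun_calc_approx_eigen[OF v t e'(2)] by blast
  obtain x where x: "norm x = 1" "norm (A x - z *\<^sub>C x) < min (min (d1 / k) (d2 / k)) (e / 3 / k)"
    using approx_eigenvector[of z "min (min (d1 / k) (d2 / k)) (e / 3 / k)"] t d1 d2 e' k
    unfolding t_def by auto
  let ?r = "A x - z *\<^sub>C x"
  have kr: "k * norm ?r < d1" "k * norm ?r < d2" "k * norm ?r < e / 3"
    using x(2) k by (simp_all add: pos_less_divide_eq mult.commute)
  \<comment> \<open>The factorisation \<open>T - |z|^2 = (A + cnj z) (A - z)\<close> turns
    approximate eigenvectors of \<open>A\<close> into ones of \<open>T\<close>.\<close>
  have "T x - t *\<^sub>C x = A ?r + cnj z *\<^sub>C ?r"
    by (simp add: t_def blinfun.diff_right antilin scaleC.diff_right scaleC_scaleC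
        complex_norm_square mult.commute del: of_real_power)
  then have "norm (T x - t *\<^sub>C x) \<le> norm A * norm ?r + cmod z * norm ?r"
    using norm_triangle_mono[OF norm_blinfun[of A ?r], of "cnj z *\<^sub>C ?r"] by (simp add: norm_scaleC)
  also have "\<dots> \<le> k * norm ?r"
    using k by (simp add: mult_right_mono flip: distrib_right)
  finally have T: "norm (T x - t *\<^sub>C x) \<le> k * norm ?r" .
  have 1: "norm (?U x - u t *\<^sub>C x) < e / 3"
    using T kr x by (intro d1) auto
  have 2: "norm (?V ?r) < e / 3"
  proof -
    have "norm (?V ?r) \<le> norm ?V * norm ?r" by (rule norm_blinfun)
    also have "\<dots> \<le> k * norm ?r" using k by (intro mult_right_mono) auto
    finally show ?thesis using kr by simp
  qed
  have 3: "norm (z *\<^sub>C (?V x - v t *\<^sub>C x)) < e / 3"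
  proof -
    have "norm (?V x - v t *\<^sub>C x) < e / 3 / k"
      using T kr x by (intro d2) auto
    then have "k * norm (?V x - v t *\<^sub>C x) < e / 3"
      using k by (simp add: pos_less_divide_eq mult.commute)
    moreover have "cmod z * norm (?V x - v t *\<^sub>C x) \<le> k * norm (?V x - v t *\<^sub>C x)"
      using k by (intro mult_right_mono) auto
    ultimately show ?thesis by (simp add: norm_scaleC)
  qed
  have "(?U + (?V o\<^sub>L A)) x - (u t + v t * z) *\<^sub>C x
      = ((?U x - u t *\<^sub>C x) + ?V ?r) + z *\<^sub>C (?V x - v t *\<^sub>C x)"
    by (simp add: blinfun.add_left blinfun.diff_right V_scaleC scaleC.add_left scaleC.diff_right
        scaleC_scaleC mult.commute)
  then have "norm ((?U + (?V o\<^sub>L A)) x - (u t + v t * z) *\<^sub>C x)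
      \<le> norm (?U x - u t *\<^sub>C x) + norm (?V ?r) + norm (z *\<^sub>C (?V x - v t *\<^sub>C x))"
    by (metis (no_types) add_right_mono norm_triangle_ineq order_trans)
  then show "\<exists>x. norm x = 1 \<and> norm ((?U + (?V o\<^sub>L A)) x - (u t + v t * z) *\<^sub>C x) < e"
    using 1 2 3 x(1) by (intro exI[of _ x]) linarith
qed

lemma biradial_spectrum_superset:
  assumes u: "continuous_on (spectrum T) u" and v: "continuous_on (spectrum T) v"
    and c: "c \<in> spectrum (cont_fun_calc u T + (cont_fun_calc v T o\<^sub>L A))"
  obtains z where "z \<in> spectrum A"
    "c = u (complex_of_real ((cmod z)\<^sup>2)) + v (complex_of_real ((cmod z)\<^sup>2)) * z"
proof -
  obtain t where t: "t \<in> spectrum T" "(c - u t) * cnj (c - u t) - t * (v t * cnj (v t)) = 0"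
    using biradial_invertible[OF u v, of c] c unfolding spectrum_def by blast
  have t': "t = complex_of_real (Re t)" "0 \<le> Re t"
    using square.spectrum_real spectrum_square_nonneg t(1) by (auto simp: Reals_def)
  have "complex_of_real ((cmod (c - u t))\<^sup>2) = complex_of_real (Re t * (cmod (v t))\<^sup>2)"
    using t(2) by (subst of_real_mult, subst t'(1)[symmetric]) (simp only: complex_norm_square right_minus_eq)
  then have eq: "(cmod (c - u t))\<^sup>2 = Re t * (cmod (v t))\<^sup>2"
    unfolding of_real_eq_iff .
  \<comment> \<open>If \<open>v t = 0\<close>, then \<open>c = u t\<close> and any \<open>z\<close>
    of modulus \<open>sqrt (Re t)\<close> works; otherwise \<open>z\<close> is forced, and
    \<open>eq\<close> gives its modulus.\<close>
  define z where "z = (if v t = 0 then complex_of_real (sqrt (Re t)) else (c - u t) / v t)"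
  have "(cmod z)\<^sup>2 = Re t"
    using t'(2) eq by (simp add: z_def norm_divide power_divide)
  then have tz: "complex_of_real ((cmod z)\<^sup>2) = t"
    using t'(1) by simp
  show ?thesis
  proof (rule that[of z])
    show "z \<in> spectrum A" using t(1) by (simp only: spectrum_iff tz)
    show "c = u (complex_of_real ((cmod z)\<^sup>2)) + v (complex_of_real ((cmod z)\<^sup>2)) * z"
      unfolding tz using eq by (cases "v t = 0") (simp_all add: z_def)
  qed
qed

end

theorem theorem2p7:
  fixes A :: "'a::complex_hilbert_space \<Rightarrow>\<^sub>L 'a"
    and u v fhat :: "complex \<Rightarrow> complex"
  assumes "antilinear A"
    and "self_adjoint A"
    and "continuous_on (spectrum (A o\<^sub>L A)) u"
    and "continuous_on (spectrum (A o\<^sub>L A)) v"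
    and "continuous_on (spectrum A) fhat"
    and "\<And>z. z \<in> spectrum A \<Longrightarrow>
      fhat z = u (complex_of_real ((cmod z)\<^sup>2)) + v (complex_of_real ((cmod z)\<^sup>2)) * z"
  shows "fhat ` spectrum A =
    spectrum (cont_fun_calc u (A o\<^sub>L A) + (cont_fun_calc v (A o\<^sub>L A) o\<^sub>L A))"
proof -
  interpret antilinear_self_adjoint_operator A
  proof
    show "A (c *\<^sub>C x) = cnj c *\<^sub>C A x" for c x
      using assms(1) unfolding antilinear_def
      by (metis blinfun_apply_blinfun_compose scalar_op.rep_eq)
    show "inner (A x) y = inner x (A y)" for x y
      using assms(2) by (simp add: self_adjoint_def is_adjoint_def Re_cinner)
  qed
  show ?thesis
  proof (intro equalityI subsetI)
    show "c \<in> spectrum (cont_fun_calc u T + (cont_fun_calc v T o\<^sub>L A))"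
      if "c \<in> fhat ` spectrum A" for c
      using that biradial_spectrum_subset[OF assms(3,4)] assms(6) by auto
    show "c \<in> fhat ` spectrum A"
      if "c \<in> spectrum (cont_fun_calc u T + (cont_fun_calc v T o\<^sub>L A))" for c
      using biradial_spectrum_superset[OF assms(3,4) that] assms(6) by (metis imageI)
  qed
qed

end
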